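(* Let $e\in\mathbb{R}$ with $e\geq f(y_n,x_n)$ for all $n\in\mathbb{N}$ and let $M>0$ with $M\geq\lVert\xi_n\rVert$ for all $n\in\mathbb{N}$. Let $\lambda_n\in[a,b]\subseteq(0,2/M^2)$ for all $n\in\mathbb{N}$ and let $L\geq\mathrm{diam}\{x_n\mid n\in\mathbb{N}\}$ ($L\in\mathbb{R}$). Let $\varepsilon_n\geq 0$, $\varepsilon_n\to 0$ $(n\to\infty)$ and let $\tau:\mathbb{N}\to\mathbb{N}$ be a nondecreasing rate of convergence for $\varepsilon_n\to 0$. Let $u\in\Omega\neq\emptyset$ with $c_u\geq\lVert x_0-u\rVert^2$. In addition, for every $j\in\mathbb{N}$ let $\sigma_j:\mathbb{N}\to\mathbb{N}$ be a modulus of uniform continuity for $f(y_j,\cdot)$ on $\overline{B_L(x_0)}$. Then for all $k\in\mathbb{N}$ and all $g:\mathbb{N}\to\mathbb{N}$: \[ \exists n\leq\tilde\Sigma(k,g)\ \forall i,j\in[n;n+g(n)]\ \left(\lVert x_i-x_j\rVert\leq\frac{1}{k+1}\ \text{ and }\ x_i\in\Omega'_k\right), \] where $\tilde\Sigma(k,g):=\Sigma_0(P(k_0),k_0,g,\chi_k,\Phi)$ with \[ k_0:=\max\left\{k,\left\lceil\frac{\omega_\Omega(k)-1}{2}\right\rceil\right\},\qquad \chi_k(n,m,r):=\max\{\delta_\Omega(k),\chi(n,m,r)\}, \] \[ \delta_\Omega(k):=2k+1,\qquad \sigma_j^{\max}(k):=\max\{\sigma_i(k)\mid i\leq j\},\qquad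 \omega_\Omega(k):=\max\{4k+3,\sigma_k^{\max}(2k+1)\}, \] and $P$, $\chi$, $\Phi$, $\Sigma_0$ are the functions defined by \[ P(k):=\left\lceil(8k+8)\sqrt{N}L\right\rceil^N,\qquad \chi(n,m,r):=\max\left\{n+m,\left\lfloor(r+1)^2m^2\beta(b,e,M)\right\rfloor\right\}, \] \[ \Phi(k):=2\left\lceil c_u\cdot(\sigma(a,b,M,L))^4\,16(k+1)^4\right\rceil+\max\{k,\tau(2k+1)\}+1, \] \[ \alpha(a,b,M):=-a(M^2b-2),\qquad \beta(b,e,M):=\left(1+\sqrt{2be(1+M)}\right)^2, \] \[ \sigma(a,b,M,L):=\left\lceil\frac{\sqrt{2MbL}}{\sqrt[4]{\alpha(a,b,M)}}+\frac{Mb+1}{\sqrt{\alpha(a,b,M)}}+1\right\rceil, \] and, for any function $\theta:\mathbb{N}^3\to\mathbb{N}$, with $\theta_g(n,q):=\theta(n,g(n),q)$ and $\theta_g^{\max}(n,q):=\max\{\theta_g(i,q)\mid i\leq n\}$, \[ \Sigma_0(0,q,g,\theta,\Phi):=0,\qquad \Sigma_0(n+1,q,g,\theta,\Phi):=\Phi\left(\theta_g^{\max}(\Sigma_0(n,q,g,\theta,\Phi),4q+3)\right). \]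
   Context: Notation: $\mathbb{N}=\{0,1,2,\dots\}$, $[n;m]:=\{n,n+1,\dots,m\}$. $\mathbb{R}^N$ ($N\geq1$) carries the Euclidean inner product and norm; $\overline{B_r(x)}$ is the closed ball. Setting: $f:\mathbb{R}^N\times\mathbb{R}^N\to\mathbb{R}$ satisfies: $f(x,x)=0$ for all $x$; $f(\cdot,y)$ is continuous for every $y$; $f(x,\cdot)$ is convex for every $x$. $T:\mathbb{R}^N\to\mathbb{R}^N$ is firmly nonexpansive, i.e. $\lVert Tx-Ty\rVert^2\leq\langle x-y,Tx-Ty\rangle$ for all $x,y$, with nonempty fixed point set $\mathrm{Fix}(T)$. The sequences are generated by the following algorithm: $x_0\in\mathbb{R}^N$ is arbitrary, $\rho_0:=\lVert x_0\rVert$. Given $x_n$ and $\rho_n$, choose $\varepsilon_n\geq0$ and $\lambda_n>0$; take $y_n\in K_n:=\overline{B_{\rho_n+1}(0)}$ with $f(y_n,x_n)\geq0$ and $\max_{y\in K_n}f(y,x_n)\leq f(y_n,x_n)+\varepsilon_n$; choose any $\xi_n\in\partial f(y_n,\cdot)(x_n)$ (subdifferential of the convex function $f(y_n,\cdot)$ at $x_n$); set $x_{n+1}:=T(x_n-\lambda_nf(y_n,x_n)\xi_n)$ and $\rho_{n+1}:=\max\{\rho_n,\lVert x_{n+1}\rVert\}$. $\Omega_n:=\{u\in\mathrm{Fix}(T)\mid f(y_n,u)\leq0\}$, $\Omega:=\bigcap_{n\in\mathbb{N}}\Omega_n$, and \[\Omega'_k:=\left\{u\in\mathbb{R}^N\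 \middle|\ \lVert u-Tu\rVert\leq\tfrac1{k+1}\text{ and }f(y_j,u)\leq\tfrac1{k+1}\text{ for all }j\leq k\right\}.\] A nondecreasing rate of convergence for $\varepsilon_n\to0$ is a function $\tau:\mathbb{N}\to\mathbb{N}$ with $\tau(k+1)\geq\tau(k)$ and $\varepsilon_n\leq\frac1{k+1}$ for all $k\in\mathbb{N}$ and $n\geq\tau(k)$. A modulus of uniform continuity for $h:D\to\mathbb{R}$ on $D\subseteq\mathbb{R}^N$ is a function $\sigma:\mathbb{N}\to\mathbb{N}$ such that for all $k\in\mathbb{N}$ and $x,x'\in D$: $\lVert x-x'\rVert\leq\frac1{\sigma(k)+1}$ implies $|h(x)-h(x')|\leq\frac1{k+1}$. *)

theory Defs
  imports "HOL-Analysis.Analysis"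
begin

definition firmly_nonexpansive :: "('a::real_inner \<Rightarrow> 'a) \<Rightarrow> bool" where
  "firmly_nonexpansive T \<longleftrightarrow>
     (\<forall>x y. (norm (T x - T y))\<^sup>2 \<le> (x - y) \<bullet> (T x - T y))"

definition Fix :: "('a \<Rightarrow> 'a) \<Rightarrow> 'a set" where
  "Fix T = {x. T x = x}"

definition subdifferential :: "('a::real_inner \<Rightarrow> real) \<Rightarrow> 'a \<Rightarrow> 'a set" where
  "subdifferential h x = {\<xi>. \<forall>z. h x + \<xi> \<bullet> (z - x) \<le> h z}"

definition equilibrium_bifunction :: "('a::real_normed_vector \<Rightarrow> 'a \<Rightarrow> real) \<Rightarrow> bool" where
  "equilibrium_bifunction f \<longleftrightarrow>
     (\<forall>x. f x x = 0) \<and>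
     (\<forall>y. continuous_on UNIV (\<lambda>x. f x y)) \<and>
     (\<forall>x. convex_on UNIV (f x))"

text \<open>
  The iteration makes choices (\<open>y\<close>, \<open>\<xi>\<close>, and the parameters \<open>\<epsilon>\<close>, \<open>lam\<close>), so it is a
  predicate on all the sequences involved. For an equilibrium bifunction, the supremum
  below is the maximum of a continuous function on a nonempty compact ball.
\<close>

definition generated_sequences ::
  "('a::real_inner \<Rightarrow> 'a \<Rightarrow> real) \<Rightarrow> ('a \<Rightarrow> 'a) \<Rightarrow> (nat \<Rightarrow> real) \<Rightarrow> (nat \<Rightarrow> real) \<Rightarrow>
   (nat \<Rightarrow> 'a) \<Rightarrow> (nat \<Rightarrow> real) \<Rightarrow> (nat \<Rightarrow> 'a) \<Rightarrow> (nat \<Rightarrow> 'a) \<Rightarrow> bool" where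
  "generated_sequences f T \<epsilon> lam x \<rho> y \<xi> \<longleftrightarrow>
     \<rho> 0 = norm (x 0) \<and>
     (\<forall>n. 0 \<le> \<epsilon> n \<and> 0 < lam n \<and>
          y n \<in> cball 0 (\<rho> n + 1) \<and>
          0 \<le> f (y n) (x n) \<and>
          (SUP z\<in>cball 0 (\<rho> n + 1). f z (x n)) \<le> f (y n) (x n) + \<epsilon> n \<and>
          \<xi> n \<in> subdifferential (f (y n)) (x n) \<and>
          x (Suc n) = T (x n - (lam n * f (y n) (x n)) *\<^sub>R \<xi> n) \<and>
          \<rho> (Suc n) = max (\<rho> n) (norm (x (Suc n))))"

definition Omega_n ::
  "('a \<Rightarrow> 'a \<Rightarrow> real) \<Rightarrow> ('a \<Rightarrow> 'a) \<Rightarrow> (nat \<Rightarrow> 'a) \<Rightarrow> nat \<Rightarrow> 'a set" where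
  "Omega_n f T y n = {u \<in> Fix T. f (y n) u \<le> 0}"

definition Omega ::
  "('a \<Rightarrow> 'a \<Rightarrow> real) \<Rightarrow> ('a \<Rightarrow> 'a) \<Rightarrow> (nat \<Rightarrow> 'a) \<Rightarrow> 'a set" where
  "Omega f T y = (\<Inter>n. Omega_n f T y n)"

definition Omega_approx ::
  "('a::real_normed_vector \<Rightarrow> 'a \<Rightarrow> real) \<Rightarrow> ('a \<Rightarrow> 'a) \<Rightarrow> (nat \<Rightarrow> 'a) \<Rightarrow> nat \<Rightarrow> 'a set" where
  "Omega_approx f T y k =
     {u. norm (u - T u) \<le> 1 / (real k + 1) \<and> (\<forall>j\<le>k. f (y j) u \<le> 1 / (real k + 1))}"

definition nondecreasing_rate_to_zero :: "(nat \<Rightarrow> nat) \<Rightarrow> (nat \<Rightarrow> real) \<Rightarrow> bool" where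
  "nondecreasing_rate_to_zero \<tau> \<epsilon> \<longleftrightarrow>
     (\<forall>k. \<tau> k \<le> \<tau> (k + 1)) \<and> (\<forall>k n. \<tau> k \<le> n \<longrightarrow> \<epsilon> n \<le> 1 / (real k + 1))"

definition modulus_uniform_continuity ::
  "(nat \<Rightarrow> nat) \<Rightarrow> 'a::real_normed_vector set \<Rightarrow> ('a \<Rightarrow> real) \<Rightarrow> bool" where
  "modulus_uniform_continuity \<sigma> D h \<longleftrightarrow>
     (\<forall>k. \<forall>x\<in>D. \<forall>x'\<in>D. norm (x - x') \<le> 1 / (real (\<sigma> k) + 1) \<longrightarrow>
        \<bar>h x - h x'\<bar> \<le> 1 / (real k + 1))"

text \<open>
  Below, \<open>nat\<close> of a ceiling or floor never truncates for the admissible parameters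
  (\<open>L \<ge> 0\<close>, \<open>cu \<ge> 0\<close>, \<open>M > 0\<close>, \<open>0 < a \<le> b < 2 / M\<^sup>2\<close>): all the rounded numbers are nonnegative.
\<close>

definition P_fun :: "nat \<Rightarrow> real \<Rightarrow> nat \<Rightarrow> nat" where
  "P_fun N L k = (nat \<lceil>(8 * real k + 8) * sqrt (real N) * L\<rceil>) ^ N"

definition alpha :: "real \<Rightarrow> real \<Rightarrow> real \<Rightarrow> real" where
  "alpha a b M = - a * (M\<^sup>2 * b - 2)"

definition beta :: "real \<Rightarrow> real \<Rightarrow> real \<Rightarrow> real" where
  "beta b e M = (1 + sqrt (2 * b * e * (1 + M)))\<^sup>2"

definition sigma_const :: "real \<Rightarrow> real \<Rightarrow> real \<Rightarrow> real \<Rightarrow> nat" where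
  "sigma_const a b M L =
     nat \<lceil>sqrt (2 * M * b * L) / root 4 (alpha a b M) + (M * b + 1) / sqrt (alpha a b M) + 1\<rceil>"

definition chi :: "real \<Rightarrow> real \<Rightarrow> real \<Rightarrow> nat \<Rightarrow> nat \<Rightarrow> nat \<Rightarrow> nat" where
  "chi b e M n m r = max (n + m) (nat \<lfloor>(real r + 1)\<^sup>2 * (real m)\<^sup>2 * beta b e M\<rfloor>)"

definition Phi_fun ::
  "real \<Rightarrow> real \<Rightarrow> real \<Rightarrow> real \<Rightarrow> real \<Rightarrow> (nat \<Rightarrow> nat) \<Rightarrow> nat \<Rightarrow> nat" where
  "Phi_fun cu a b M L \<tau> k =
     2 * nat \<lceil>cu * (real (sigma_const a b M L)) ^ 4 * 16 * (real k + 1) ^ 4\<rceil>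
     + max k (\<tau> (2 * k + 1)) + 1"

definition theta_g_max ::
  "(nat \<Rightarrow> nat \<Rightarrow> nat \<Rightarrow> nat) \<Rightarrow> (nat \<Rightarrow> nat) \<Rightarrow> nat \<Rightarrow> nat \<Rightarrow> nat" where
  "theta_g_max \<theta> g n q = Max ((\<lambda>i. \<theta> i (g i) q) ` {..n})"

primrec Sigma0 ::
  "nat \<Rightarrow> nat \<Rightarrow> (nat \<Rightarrow> nat) \<Rightarrow> (nat \<Rightarrow> nat \<Rightarrow> nat \<Rightarrow> nat) \<Rightarrow> (nat \<Rightarrow> nat) \<Rightarrow> nat" where
  "Sigma0 0 q g \<theta> \<Phi> = 0"
| "Sigma0 (Suc n) q g \<theta> \<Phi> = \<Phi> (theta_g_max \<theta> g (Sigma0 n q g \<theta> \<Phi>) (4 * q + 3))"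

definition delta_Omega :: "nat \<Rightarrow> nat" where
  "delta_Omega k = 2 * k + 1"

definition sigma_max :: "(nat \<Rightarrow> nat \<Rightarrow> nat) \<Rightarrow> nat \<Rightarrow> nat \<Rightarrow> nat" where
  "sigma_max \<sigma> j k = Max ((\<lambda>i. \<sigma> i k) ` {..j})"

definition omega_Omega :: "(nat \<Rightarrow> nat \<Rightarrow> nat) \<Rightarrow> nat \<Rightarrow> nat" where
  "omega_Omega \<sigma> k = max (4 * k + 3) (sigma_max \<sigma> k (2 * k + 1))"

definition k0 :: "(nat \<Rightarrow> nat \<Rightarrow> nat) \<Rightarrow> nat \<Rightarrow> nat" where
  "k0 \<sigma> k = max k (nat \<lceil>(real (omega_Omega \<sigma> k) - 1) / 2\<rceil>)"

definition chi_k ::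
  "real \<Rightarrow> real \<Rightarrow> real \<Rightarrow> nat \<Rightarrow> nat \<Rightarrow> nat \<Rightarrow> nat \<Rightarrow> nat" where
  "chi_k b e M k n m r = max (delta_Omega k) (chi b e M n m r)"

text \<open>\<open>N\<close> is the dimension of the space; \<open>\<sigma> j\<close> is the modulus belonging to \<open>y j\<close>.\<close>

definition Sigma_tilde ::
  "nat \<Rightarrow> real \<Rightarrow> real \<Rightarrow> real \<Rightarrow> real \<Rightarrow> real \<Rightarrow> real \<Rightarrow> (nat \<Rightarrow> nat) \<Rightarrow>
   (nat \<Rightarrow> nat \<Rightarrow> nat) \<Rightarrow> nat \<Rightarrow> (nat \<Rightarrow> nat) \<Rightarrow> nat" where
  "Sigma_tilde N L e M a b cu \<tau> \<sigma> k g =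
     Sigma0 (P_fun N L (k0 \<sigma> k)) (k0 \<sigma> k) g (chi_k b e M k) (Phi_fun cu a b M L \<tau>)"

end

theory Submission
  imports Defs
begin

text \<open>
  The sequence is Fejer monotone with respect to \<open>\<Omega>\<close>, and this survives, up to an error, when
  points of \<open>\<Omega>\<close> are replaced by the approximate solutions in \<open>\<Omega>'\<^sub>k\<close>. Three ingredients are combined.

  \<^item> Since the subgradient step towards \<open>{v. f (y n) v \<le> 0}\<close> followed by \<open>T\<close> lowers the squared
    distance to \<open>u \<in> \<Omega>\<close> by at least \<open>\<alpha> (f (y n) (x n))\<^sup>2 + \<parallel>w n - T (w n)\<parallel>\<^sup>2\<close>, where \<open>w n\<close> is the
    point between the two, these quantities are summable with sum at most \<open>\<parallel>x 0 - u\<parallel>\<^sup>2\<close>. So any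
    long enough block of indices contains one at which they are small, and there \<open>x n\<close> lies
    in \<open>\<Omega>'\<^sub>k\<close> if \<open>n\<close> is large enough: the almost maximality of \<open>y n\<close> on the
    ball \<open>K\<^sub>n\<close>, which contains all earlier \<open>y j\<close>, bounds \<open>f (y j) (x n)\<close> for all \<open>j \<le> n\<close>
    at once (\<open>approximate_solution_bound\<close>).
  \<^item> If \<open>p\<close> is only a \<open>\<delta>\<close>-approximate solution, each step increases the distance to \<open>p\<close> by at most
    \<open>\<delta> + \<surd>(2 b e \<delta>)\<close>. Over \<open>m\<close> steps this is at most \<open>1 / (r + 1)\<close> once \<open>\<delta>\<close> is of the order
    \<open>1 / ((r + 1)\<^sup>2 m\<^sup>2)\<close> (\<open>uniformly_fejer\<close>).
  \<^item> A set of diameter \<open>L\<close> in \<open>\<real>\<^sup>N\<close> lies in a cube of side \<open>L\<close>, so that the pigeonhole principle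
    finds two close points in every long enough sequence (\<open>ex_two_close_points\<close>).

  Approximate solutions \<open>x (z 1), x (z 2), \<dots>\<close> are chosen one after the other, each so good that
  the iteration started at any earlier \<open>z i\<close> moves hardly farther away from it within \<open>g (z i)\<close>
  steps. Two of these points, or \<open>x (z 0) = x 0\<close> and one of them, are close, and the
  earlier of the two indices starts the desired interval, because all iterates on it stay near the later point (\<open>fejer_metastability\<close>). This later
  point is an approximate solution, and uniform continuity of the \<open>f (y j)\<close> transfers this property
  to the iterates near it.
\<close>

section \<open>Close points in a bounded sequence\<close>

lemma ex_grid_cell:
  fixes v L :: real
  assumes "0 \<le> v" "v \<le> L" "0 < D"
  shows "\<exists>j<D. real j * (L / D) \<le> v \<and> v \<le> (real j + 1) * (L / D)"
proof (cases "v = L")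
  case True
  have "real (D - 1) = real D - 1" using assms by linarith
  with True assms show ?thesis
    by (intro exI[of _ "D - 1"]) (auto simp: field_simps)
next
  case False
  then have L: "0 < L" "v < L" using assms by auto
  define j where "j = nat \<lfloor>v * D / L\<rfloor>"
  have nn: "0 \<le> v * D / L" using assms L by simp
  have j: "real j \<le> v * D / L" "v * D / L < real j + 1"
    unfolding j_def using nn by linarith+
  have "v * D / L < D" using L assms by (simp add: field_simps)
  with j have "j < D" by linarith
  moreover have "real j * (L / D) \<le> v" "v \<le> (real j + 1) * (L / D)"
    using j L(1) \<open>0 < D\<close> by (simp_all add: pos_le_divide_eq pos_divide_less_eq pos_divide_le_eq)
  ultimately show ?thesis by blast
qed

lemma norm_le_sqrt_card:
  fixes v :: "real ^ 'n"
  assumes "\<And>i. \<bar>v $ i\<bar> \<le> s"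
  shows "norm v \<le> sqrt (real CARD('n)) * s"
proof -
  have s: "0 \<le> s" using assms[of undefined] by linarith
  have "(\<Sum>i\<in>UNIV. (v $ i)\<^sup>2) \<le> (\<Sum>i\<in>(UNIV::'n set). s\<^sup>2)"
    using assms s by (intro sum_mono) (metis abs_le_square_iff abs_of_nonneg)
  then have "norm v \<le> sqrt (real CARD('n) * s\<^sup>2)"
    by (simp add: norm_vec_def L2_set_def)
  then show ?thesis using s by (simp add: real_sqrt_mult)
qed

text \<open>
  The points lie in a cube of side \<open>L\<close>; it is divided into cubes whose side \<open>L / D\<close> is small
  enough for their diagonal to be at most \<open>1 / c\<close>. The bound restricts only the smaller of the two
  indices, so that the case \<open>L = 0\<close>, with its bound \<open>0\<close>, is covered.
\<close>

lemma ex_two_close_points: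
  fixes z :: "nat \<Rightarrow> real ^ 'n"
  assumes L: "\<And>i j. norm (z i - z j) \<le> L" and c: "0 < c"
  shows "\<exists>i j. i < j \<and> i \<le> (nat \<lceil>c * sqrt (real CARD('n)) * L\<rceil>) ^ CARD('n) \<and>
               norm (z i - z j) \<le> 1 / c"
proof -
  define D where "D = nat \<lceil>c * sqrt (real CARD('n)) * L\<rceil>"
  have cN: "0 < c * sqrt (real CARD('n))" using c by simp
  have D: "c * sqrt (real CARD('n)) * L \<le> D" unfolding D_def by linarith
  show ?thesis
  proof (cases "D = 0")
    case True
    with D have "c * sqrt (real CARD('n)) * L \<le> 0" by simp
    with cN have "L \<le> 0" using mult_pos_pos not_le by metis
    with L[of 0 1] have "norm (z 0 - z 1) = 0" by (metis norm_ge_zero order.antisym order.trans)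
    with c have "norm (z 0 - z 1) \<le> 1 / c" by simp
    then show ?thesis by (intro exI[of _ 0] exI[of _ 1]) auto
  next
    case False
    define Q where "Q = D ^ CARD('n)"
    define m where "m h = Min ((\<lambda>i. z i $ h) ` {..Q})" for h
    have low: "m h \<le> z i $ h" if "i \<le> Q" for i h
      unfolding m_def using that by (intro Min_le) auto
    have high: "z i $ h - m h \<le> L" for i h
    proof -
      have "m h \<in> (\<lambda>i. z i $ h) ` {..Q}" unfolding m_def by (intro Min_in) auto
      then obtain j where "m h = z j $ h" by auto
      then have "z i $ h - m h = (z i - z j) $ h" by simp
      also have "\<dots> \<le> norm (z i - z j)" using component_le_norm_cart abs_le_D1 by blast
      finally show ?thesis using L[of i j] by linarith
    qed
    have "\<forall>i h. \<exists>j. i \<le> Q \<longrightarrow> j < D \<and> real j * (L / D) \<le> z i $ h - m h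
                 \<and> z i $ h - m h \<le> (real j + 1) * (L / D)"
      using ex_grid_cell[of _ L D] low high False by (metis diff_ge_0_iff_ge neq0_conv)
    then obtain cell where cell: "cell i h < D" "real (cell i h) * (L / D) \<le> z i $ h - m h"
        "z i $ h - m h \<le> (real (cell i h) + 1) * (L / D)" if "i \<le> Q" for i h
      by metis
    have "cell ` {..Q} \<subseteq> PiE UNIV (\<lambda>_::'n. {..<D})" using cell by auto
    then have "card (cell ` {..Q}) \<le> card (PiE UNIV (\<lambda>_::'n. {..<D}))"
      by (intro card_mono finite_PiE) auto
    then have "card (cell ` {..Q}) < card {..Q}" by (simp add: card_PiE Q_def)
    then have "\<not> inj_on cell {..Q}" by (rule pigeonhole)
    then obtain i j where ij: "i < j" "j \<le> Q" "cell i = cell j"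
      unfolding inj_on_def by (metis atMost_iff nat_neq_iff)
    have "\<bar>(z i - z j) $ h\<bar> \<le> L / D" for h
      using cell[of i h] cell[of j h] ij by (auto simp: abs_le_iff algebra_simps)
    then have "norm (z i - z j) \<le> sqrt (real CARD('n)) * (L / D)" by (rule norm_le_sqrt_card)
    also have "\<dots> \<le> 1 / c" using D c False by (simp add: field_simps)
    finally show ?thesis using ij unfolding Q_def D_def
      by (intro exI[of _ i] exI[of _ j]) auto
  qed
qed

section \<open>Metastability of uniformly Fejer monotone sequences\<close>

lemma theta_g_max_ge: "i \<le> n \<Longrightarrow> \<theta> i (g i) q \<le> theta_g_max \<theta> g n q"
  unfolding theta_g_max_def by (intro Max_ge) auto

lemma theta_g_max_mono: "n \<le> n' \<Longrightarrow> theta_g_max \<theta> g n q \<le> theta_g_max \<theta> g n' q"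
  unfolding theta_g_max_def by (intro Max_mono) auto

lemma mono_Sigma0:
  assumes "mono \<Phi>"
  shows "mono (\<lambda>n. Sigma0 n q g \<theta> \<Phi>)"
proof (rule mono_iff_le_Suc[THEN iffD2], rule allI)
  fix n show "Sigma0 n q g \<theta> \<Phi> \<le> Sigma0 (Suc n) q g \<theta> \<Phi>"
    by (induction n) (auto intro!: monoD[OF assms] theta_g_max_mono)
qed

text \<open>
  The set \<open>A k\<close> consists of the approximate solutions of quality \<open>k\<close>. The point \<open>x (z (Suc i))\<close>
  is taken in \<open>A\<close> at the quality required by all possible starting indices up to
  \<open>Sigma0 i q g \<theta> \<Phi>\<close>, a bound for \<open>z 0, \<dots>, z i\<close>. The number \<open>3 / (8 (q + 1))\<close> is the
  distance \<open>1 / (8 (q + 1))\<close> of the two close points plus the growth \<open>1 / (4 q + 4)\<close>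
  allowed by the Fejer property.
\<close>

lemma fejer_metastability:
  fixes x :: "nat \<Rightarrow> 'a::metric_space"
  assumes A: "antimono A"
    and \<Phi>: "mono \<Phi>" "\<And>k. \<exists>n\<le>\<Phi> k. x n \<in> A k"
    and fejer: "\<And>n m r p l. p \<in> A (\<theta> n m r) \<Longrightarrow> l \<le> m \<Longrightarrow>
                  dist (x (n + l)) p \<le> dist (x n) p + 1 / (real r + 1)"
    and close: "\<And>z :: nat \<Rightarrow> nat. \<exists>i j. i < j \<and> i \<le> P \<and>
                  dist (x (z i)) (x (z j)) \<le> 1 / (8 * real q + 8)"
  shows "\<exists>n \<le> Sigma0 P q g \<theta> \<Phi>. \<exists>m. x m \<in> A (\<theta> n (g n) (4 * q + 3)) \<and>
           (\<forall>i\<in>{n..n + g n}. dist (x i) (x m) \<le> 3 / (8 * (real q + 1)))"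
proof -
  define S where "S n = Sigma0 n q g \<theta> \<Phi>" for n
  define K where "K n = theta_g_max \<theta> g (S n) (4 * q + 3)" for n
  have S_Suc: "S (Suc n) = \<Phi> (K n)" for n unfolding S_def K_def by simp
  have monoS: "S i \<le> S j" if "i \<le> j" for i j
    using monoD[OF mono_Sigma0[OF \<Phi>(1)] that] unfolding S_def .
  obtain h where h: "h k \<le> \<Phi> k" "x (h k) \<in> A k" for k using \<Phi>(2) by metis
  \<comment> \<open>The point \<open>x 0\<close> need not be an approximate solution: it can only be the earlier of two points.\<close>
  define z where "z n = (case n of 0 \<Rightarrow> 0 | Suc m \<Rightarrow> h (K m))" for n
  have zS: "z n \<le> S n" for n
    by (cases n) (auto simp: z_def S_Suc h(1))
  obtain i j where ij: "i < j" "i \<le> P" "dist (x (z i)) (x (z j)) \<le> 1 / (8 * real q + 8)"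
    using close[of z] by blast
  then obtain j' where j': "j = Suc j'" "i \<le> j'" by (cases j) auto
  define n where "n = z i"
  have "n \<le> S j'" using zS[of i] monoS[OF j'(2)] by (simp add: n_def)
  then have "\<theta> n (g n) (4 * q + 3) \<le> K j'" unfolding K_def by (rule theta_g_max_ge)
  moreover have "x (z j) \<in> A (K j')" using h(2) by (simp add: z_def j')
  ultimately have in_A: "x (z j) \<in> A (\<theta> n (g n) (4 * q + 3))"
    using antimonoD[OF A] by blast
  have "dist (x k) (x (z j)) \<le> 3 / (8 * (real q + 1))" if "k \<in> {n..n + g n}" for k
  proof -
    have "dist (x (n + (k - n))) (x (z j)) \<le> dist (x n) (x (z j)) + 1 / (real (4 * q + 3) + 1)"
      using that by (intro fejer[OF in_A]) auto
    also have "\<dots> \<le> 1 / (8 * real q + 8) + 1 / (real (4 * q + 3) + 1)"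
      using ij(3) by (simp add: n_def)
    also have "\<dots> = 3 / (8 * (real q + 1))" by (simp add: divide_simps)
    finally show ?thesis using that by simp
  qed
  moreover have "n \<le> S P" using zS[of i] monoS[OF ij(2)] by (simp add: n_def)
  ultimately show ?thesis using in_A unfolding S_def by blast
qed

section \<open>Firmly nonexpansive maps and approximate solutions\<close>

lemma firmly_nonexpansive_imp_nonexpansive:
  assumes "firmly_nonexpansive T"
  shows "norm (T p - T q) \<le> norm (p - q)"
proof (cases "T p = T q")
  case False
  have "(norm (T p - T q))\<^sup>2 \<le> (p - q) \<bullet> (T p - T q)"
    using assms unfolding firmly_nonexpansive_def by blast
  also have "\<dots> \<le> norm (p - q) * norm (T p - T q)" by (rule norm_cauchy_schwarz)
  finally have "norm (T p - T q) * norm (T p - T q) \<le> norm (p - q) * norm (T p - T q)"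
    by (simp only: power2_eq_square)
  moreover have "0 < norm (T p - T q)" using False by simp
  ultimately show ?thesis by (rule mult_right_le_imp_le)
qed simp

lemma firmly_nonexpansive_Fix:
  assumes "firmly_nonexpansive T" "u \<in> Fix T"
  shows "(norm (T w - u))\<^sup>2 + (norm (w - T w))\<^sup>2 \<le> (norm (w - u))\<^sup>2"
proof -
  have "(norm (T w - T u))\<^sup>2 \<le> (w - u) \<bullet> (T w - T u)"
    using assms(1) unfolding firmly_nonexpansive_def by blast
  moreover have "T u = u" using assms(2) by (simp add: Fix_def)
  ultimately have "(norm (T w - u))\<^sup>2 \<le> (w - u) \<bullet> (T w - u)" by simp
  then show ?thesis unfolding power2_norm_eq_inner
    by (simp add: inner_diff_left inner_diff_right inner_commute)
qed

lemma antimono_Omega_approx: "antimono (Omega_approx f T y)"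
proof (rule antimonoI, rule subsetI)
  fix k k' :: nat and v
  assume "k \<le> k'" and v: "v \<in> Omega_approx f T y k'"
  then have "1 / (real k' + 1) \<le> 1 / (real k + 1)" by (simp add: field_simps)
  with \<open>k \<le> k'\<close> v show "v \<in> Omega_approx f T y k"
    unfolding Omega_approx_def by (auto intro: order.trans dest: le_trans)
qed

text \<open>
  Half of the tolerance is spent on the approximate solution \<open>p\<close> of quality \<open>\<delta>\<^sub>\<Omega> k = 2 k + 1\<close>,
  the other half on passing from \<open>p\<close> to \<open>v\<close>; for the fixed point condition this passage costs
  twice the distance of \<open>p\<close> and \<open>v\<close>.
\<close>

lemma Omega_approx_near:
  assumes T: "firmly_nonexpansive T"
    and \<sigma>: "\<And>j. modulus_uniform_continuity (\<sigma> j) D (f (y j))"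
    and "p \<in> D" "v \<in> D" and p: "p \<in> Omega_approx f T y (delta_Omega k)"
    and pv: "norm (v - p) \<le> 1 / (real (omega_Omega \<sigma> k) + 1)"
  shows "v \<in> Omega_approx f T y k"
proof -
  have half: "2 * (1 / (real (2 * k + 1) + 1)) = 1 / (real k + 1)"
    by (simp add: divide_simps)
  have "norm (v - p) \<le> 1 / (real (4 * k + 3) + 1)"
    by (rule order.trans[OF pv]) (simp add: field_simps omega_Omega_def)
  moreover have "2 * (1 / (real (4 * k + 3) + 1)) = 1 / (real (2 * k + 1) + 1)"
    by (simp add: divide_simps)
  ultimately have "2 * norm (v - p) \<le> 1 / (real (2 * k + 1) + 1)" by linarith
  moreover have "norm (p - T p) \<le> 1 / (real (2 * k + 1) + 1)"
    using p unfolding Omega_approx_def delta_Omega_def by simp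
  moreover have "norm (v - T v) \<le> norm (v - p) + norm (p - T p) + norm (T v - T p)"
    using norm_triangle_ineq[of "v - p" "p - T p"]
      norm_triangle_ineq4[of "v - T p" "T v - T p"] by simp
  moreover have "norm (T v - T p) \<le> norm (v - p)"
    using T by (rule firmly_nonexpansive_imp_nonexpansive)
  ultimately have "norm (v - T v) \<le> 1 / (real k + 1)" using half by linarith
  moreover have "f (y j) v \<le> 1 / (real k + 1)" if "j \<le> k" for j
  proof -
    have "\<sigma> j (2 * k + 1) \<le> sigma_max \<sigma> k (2 * k + 1)"
      unfolding sigma_max_def using that by (intro Max_ge) auto
    then have "\<sigma> j (2 * k + 1) \<le> omega_Omega \<sigma> k" unfolding omega_Omega_def by simp
    then have "1 / (real (omega_Omega \<sigma> k) + 1) \<le> 1 / (real (\<sigma> j (2 * k + 1)) + 1)"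
      by (simp add: field_simps)
    with pv have "norm (v - p) \<le> 1 / (real (\<sigma> j (2 * k + 1)) + 1)" by linarith
    then have "\<bar>f (y j) v - f (y j) p\<bar> \<le> 1 / (real (2 * k + 1) + 1)"
      using \<sigma>[of j] \<open>p \<in> D\<close> \<open>v \<in> D\<close> unfolding modulus_uniform_continuity_def by blast
    moreover have "f (y j) p \<le> 1 / (real (2 * k + 1) + 1)"
      using p that unfolding Omega_approx_def delta_Omega_def by simp
    ultimately show ?thesis using half by linarith
  qed
  ultimately show ?thesis unfolding Omega_approx_def by simp
qed

section \<open>The iteration\<close>

locale bounded_run =
  fixes f :: "'a::euclidean_space \<Rightarrow> 'a \<Rightarrow> real" and T :: "'a \<Rightarrow> 'a"
    and \<epsilon> lam :: "nat \<Rightarrow> real" and x :: "nat \<Rightarrow> 'a" and \<rho> :: "nat \<Rightarrow> real"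
    and y \<xi> :: "nat \<Rightarrow> 'a" and e M a b :: real
  assumes bifunction: "equilibrium_bifunction f"
    and firm: "firmly_nonexpansive T"
    and run: "generated_sequences f T \<epsilon> lam x \<rho> y \<xi>"
    and value_le: "f (y n) (x n) \<le> e"
    and M_pos: "0 < M"
    and subgradient_le: "norm (\<xi> n) \<le> M"
    and steps: "{a..b} \<subseteq> {0<..<2 / M\<^sup>2}" "lam n \<in> {a..b}"
begin

lemma run_step:
  shows "y n \<in> cball 0 (\<rho> n + 1)"
    and value_nonneg: "0 \<le> f (y n) (x n)"
    and "(SUP z\<in>cball 0 (\<rho> n + 1). f z (x n)) \<le> f (y n) (x n) + \<epsilon> n"
    and "\<xi> n \<in> subdifferential (f (y n)) (x n)"
    and "x (Suc n) = T (x n - (lam n * f (y n) (x n)) *\<^sub>R \<xi> n)"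
    and "\<rho> (Suc n) = max (\<rho> n) (norm (x (Suc n)))"
  using run unfolding generated_sequences_def by blast+

lemma step_size: "a \<le> lam n" "lam n \<le> b"
  using steps(2)[of n] by auto

lemma step_bounds: "0 < a" "a \<le> b" "0 < b" "b * M\<^sup>2 < 2"
proof -
  show "a \<le> b" using step_size[of 0] by simp
  then have "a \<in> {0<..<2 / M\<^sup>2}" "b \<in> {0<..<2 / M\<^sup>2}" using steps(1) by auto
  then show "0 < a" "0 < b" "b * M\<^sup>2 < 2" using M_pos by (auto simp: field_simps)
qed

lemma alpha_pos: "0 < alpha a b M"
proof -
  have "0 < a * (2 - b * M\<^sup>2)" using step_bounds by simp
  then show ?thesis unfolding alpha_def by (simp add: algebra_simps)
qed

lemma e_nonneg: "0 \<le> e"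
  using value_nonneg[of 0] value_le[of 0] by simp

definition w :: "nat \<Rightarrow> 'a" where
  "w n = x n - (lam n * f (y n) (x n)) *\<^sub>R \<xi> n"

text \<open>
  The subgradient inequality gives \<open>\<xi> n \<bullet> (x n - p) \<ge> f (y n) (x n) - \<delta>\<close>; inserting this into the
  expansion of the square leaves the coefficient \<open>- lam n (2 - lam n M\<^sup>2) \<le> - \<alpha>\<close>
  of \<open>(f (y n) (x n))\<^sup>2\<close>.
\<close>

lemma subgradient_step_le:
  assumes p: "f (y n) p \<le> \<delta>" and \<delta>: "0 \<le> \<delta>"
  shows "(norm (w n - p))\<^sup>2 \<le>
           (norm (x n - p))\<^sup>2 - alpha a b M * (f (y n) (x n))\<^sup>2 + 2 * b * e * \<delta>"
proof -
  define F where "F = f (y n) (x n)"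
  define l where "l = lam n"
  have F: "0 \<le> F" "F \<le> e" unfolding F_def by (rule value_nonneg value_le)+
  have l: "0 < l" "a \<le> l" "l \<le> b" using step_bounds step_size[of n] by (auto simp: l_def)
  have "F + \<xi> n \<bullet> (p - x n) \<le> f (y n) p"
    using run_step(4)[of n] unfolding subdifferential_def F_def by blast
  with p have "F - \<delta> \<le> (x n - p) \<bullet> \<xi> n"
    by (simp add: inner_diff_left inner_diff_right inner_commute)
  then have 1: "(l * F) * (F - \<delta>) \<le> (l * F) * ((x n - p) \<bullet> \<xi> n)"
    using l F by (intro mult_left_mono) auto
  have 2: "(l * F)\<^sup>2 * (norm (\<xi> n))\<^sup>2 \<le> (l * F)\<^sup>2 * M\<^sup>2"
    using subgradient_le[of n] by (intro mult_left_mono power_mono) auto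
  have "(a * (2 - b * M\<^sup>2)) * F\<^sup>2 \<le> (l * (2 - l * M\<^sup>2)) * F\<^sup>2"
    using l step_bounds by (intro mult_right_mono mult_mono diff_left_mono) auto
  moreover have "alpha a b M = a * (2 - b * M\<^sup>2)" unfolding alpha_def by (simp add: algebra_simps)
  ultimately have 3: "alpha a b M * F\<^sup>2 \<le> l * (2 - l * M\<^sup>2) * F\<^sup>2" by simp
  have "l * F \<le> b * e" using l F step_bounds by (intro mult_mono) auto
  then have 4: "(l * F) * \<delta> \<le> (b * e) * \<delta>" using \<delta> by (rule mult_right_mono)
  have "(norm (w n - p))\<^sup>2 = (norm ((x n - p) - (l * F) *\<^sub>R \<xi> n))\<^sup>2"
    unfolding w_def F_def l_def by (simp add: algebra_simps)
  also have "\<dots> = (norm (x n - p))\<^sup>2 - 2 * ((l * F) * ((x n - p) \<bullet> \<xi> n)) + (l * F)\<^sup>2 * (norm (\<xi> n))\<^sup>2"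
    unfolding power2_norm_eq_inner
    by (simp add: inner_diff_left inner_diff_right inner_commute power2_eq_square algebra_simps)
  also have "\<dots> \<le> (norm (x n - p))\<^sup>2 - 2 * ((l * F) * (F - \<delta>)) + (l * F)\<^sup>2 * M\<^sup>2"
    using 1 2 by linarith
  also have "\<dots> = (norm (x n - p))\<^sup>2 - l * (2 - l * M\<^sup>2) * F\<^sup>2 + 2 * ((l * F) * \<delta>)"
    by (simp add: algebra_simps power2_eq_square)
  also have "\<dots> \<le> (norm (x n - p))\<^sup>2 - alpha a b M * F\<^sup>2 + 2 * b * e * \<delta>"
    using 3 4 by simp
  finally show ?thesis unfolding F_def .
qed

lemma fejer_descent:
  assumes u: "u \<in> Omega f T y"
  shows "(norm (x (Suc n) - u))\<^sup>2 +
           (alpha a b M * (f (y n) (x n))\<^sup>2 + (norm (w n - T (w n)))\<^sup>2) \<le> (norm (x n - u))\<^sup>2"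
proof -
  have "u \<in> Fix T" "f (y n) u \<le> 0" using u unfolding Omega_def Omega_n_def by auto
  then show ?thesis
    using subgradient_step_le[of n u 0] firmly_nonexpansive_Fix[OF firm, of u "w n"]
      run_step(5)[of n] by (simp add: w_def)
qed

lemma bounded_range:
  assumes "u \<in> Omega f T y"
  shows "bounded (range x)"
proof -
  have "norm (x n - u) \<le> norm (x 0 - u)" for n
  proof (induction n)
    case (Suc n)
    have "0 \<le> alpha a b M * (f (y n) (x n))\<^sup>2" using alpha_pos by simp
    then have "(norm (x (Suc n) - u))\<^sup>2 \<le> (norm (x n - u))\<^sup>2"
      using fejer_descent[OF assms, of n] by (smt (verit) zero_le_power2)
    then show ?case using Suc power2_le_imp_le norm_ge_zero order.trans by metis
  qed simp
  then have "range x \<subseteq> cball u (norm (x 0 - u))"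
    by (auto simp: dist_norm norm_minus_commute)
  then show ?thesis by (rule bounded_subset[OF bounded_cball])
qed

text \<open>The diameter of an unbounded set carries no information, so the Fejer property is used here.\<close>

lemma dist_le_diameter:
  assumes "u \<in> Omega f T y" "diameter (range x) \<le> L"
  shows "norm (x i - x j) \<le> L"
  using diameter_bounded_bound[OF bounded_range[OF assms(1)], of "x i" "x j"] assms(2)
  by (simp add: dist_norm)

text \<open>
  The choice of \<open>y n\<close> controls the values at \<open>x n\<close> of all earlier functions, since the balls
  \<open>K\<^sub>n\<close> increase with \<open>n\<close>.
\<close>

lemma earlier_value_le:
  assumes "j \<le> n"
  shows "f (y j) (x n) \<le> f (y n) (x n) + \<epsilon> n"
proof -
  have "\<rho> i \<le> \<rho> (Suc i)" for i using run_step(6)[of i] by simp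
  then have "\<rho> j \<le> \<rho> n" using assms by (rule lift_Suc_mono_le)
  then have "y j \<in> cball 0 (\<rho> n + 1)" using run_step(1)[of j] by auto
  moreover have "continuous_on (cball 0 (\<rho> n + 1)) (\<lambda>z. f z (x n))"
    using bifunction unfolding equilibrium_bifunction_def
    by (meson continuous_on_subset subset_UNIV)
  then have "bdd_above ((\<lambda>z. f z (x n)) ` cball 0 (\<rho> n + 1))"
    by (intro bounded_imp_bdd_above compact_imp_bounded compact_continuous_image) auto
  ultimately have "f (y j) (x n) \<le> (SUP z\<in>cball 0 (\<rho> n + 1). f z (x n))"
    by (rule cSUP_upper)
  then show ?thesis using run_step(3)[of n] by linarith
qed

text \<open>
  Summing the descent inequality over \<open>m\<close> consecutive indices shows that on average the
  decrease is at most \<open>cu / m\<close>.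
\<close>

lemma ex_small_decrease:
  assumes u: "u \<in> Omega f T y" and cu: "(norm (x 0 - u))\<^sup>2 \<le> cu" and m: "0 < m"
  shows "\<exists>n\<in>{s..<s + m}.
           m * (alpha a b M * (f (y n) (x n))\<^sup>2 + (norm (w n - T (w n)))\<^sup>2) \<le> cu"
proof -
  define d where "d n = alpha a b M * (f (y n) (x n))\<^sup>2 + (norm (w n - T (w n)))\<^sup>2" for n
  have d: "0 \<le> d n" for n unfolding d_def using alpha_pos by simp
  have sum: "(norm (x n - u))\<^sup>2 + sum d {..<n} \<le> cu" for n
  proof (induction n)
    case 0
    show ?case using cu by simp
  next
    case (Suc n)
    then show ?case using fejer_descent[OF u, of n] by (simp add: d_def)
  qed
  have "sum d {s..<s + m} \<le> sum d {..<s + m}"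
    using d by (intro sum_mono2) auto
  also have "\<dots> \<le> cu" using sum[of "s + m"] by (smt (verit) zero_le_power2)
  finally have le: "sum d {s..<s + m} \<le> cu" .
  show ?thesis
  proof (rule ccontr)
    assume "\<not> ?thesis"
    then have "cu / m < d n" if "n \<in> {s..<s + m}" for n
      using that m by (auto simp: d_def field_simps not_le)
    then have "(\<Sum>n\<in>{s..<s + m}. cu / m) < sum d {s..<s + m}"
      using m by (intro sum_strict_mono) auto
    with le m show False by simp
  qed
qed

lemma sigma_const_ge:
  assumes "0 \<le> L"
  shows "1 \<le> real (sigma_const a b M L)"
    and "M * b + 1 \<le> sqrt (alpha a b M) * real (sigma_const a b M L)"
proof -
  have \<alpha>: "0 < sqrt (alpha a b M)" using alpha_pos by simp
  have "0 \<le> sqrt (2 * M * b * L) / root 4 (alpha a b M)"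
    using assms M_pos step_bounds alpha_pos by (intro divide_nonneg_nonneg) auto
  moreover have q: "0 \<le> (M * b + 1) / sqrt (alpha a b M)"
    using M_pos step_bounds \<alpha> by (intro divide_nonneg_pos) auto
  moreover have "sqrt (2 * M * b * L) / root 4 (alpha a b M) + (M * b + 1) / sqrt (alpha a b M) + 1
      \<le> real (sigma_const a b M L)"
    unfolding sigma_const_def by (rule real_nat_ceiling_ge)
  ultimately have \<sigma>: "(M * b + 1) / sqrt (alpha a b M) + 1 \<le> real (sigma_const a b M L)"
    by linarith
  then show "1 \<le> real (sigma_const a b M L)" using q by linarith
  have "(M * b + 1) / sqrt (alpha a b M) \<le> real (sigma_const a b M L)" using \<sigma> by linarith
  then show "M * b + 1 \<le> sqrt (alpha a b M) * real (sigma_const a b M L)"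
    using \<alpha> by (simp add: field_simps)
qed

text \<open>
  The number \<open>(4 s\<^sup>2 (k + 1)\<^sup>2)\<^sup>2 cu\<close>, with \<open>s\<close> the integer \<open>\<sigma>(a, b, M, L)\<close>, occurs in \<open>\<Phi>\<close>: among
  that many steps there is one with decrease at most \<open>\<eta>\<^sup>2\<close> for \<open>\<eta> = 1 / (4 s\<^sup>2 (k + 1)\<^sup>2)\<close>. As \<open>\<surd>\<alpha> s \<ge> M b + 1\<close>,
  this makes \<open>(M b + 1) f (y n) (x n)\<close> small, and with it the length \<open>\<le> b M f (y n) (x n)\<close> of the
  subgradient step.
\<close>

lemma approximate_solution_bound:
  assumes u: "u \<in> Omega f T y" and cu: "(norm (x 0 - u))\<^sup>2 \<le> cu" and L: "0 \<le> L"
    and \<tau>: "nondecreasing_rate_to_zero \<tau> \<epsilon>"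
  shows "\<exists>n\<le>Phi_fun cu a b M L \<tau> k. x n \<in> Omega_approx f T y k"
proof -
  define s where "s = real (sigma_const a b M L)"
  define K where "K = real k + 1"
  define C where "C = nat \<lceil>cu * s ^ 4 * 16 * K ^ 4\<rceil>"
  define s0 where "s0 = max k (\<tau> (2 * k + 1))"
  define \<eta> where "\<eta> = 1 / (4 * s\<^sup>2 * K\<^sup>2)"
  have s: "1 \<le> s" "M * b + 1 \<le> sqrt (alpha a b M) * s"
    unfolding s_def using sigma_const_ge[OF L] by auto
  have K: "1 \<le> K" unfolding K_def by simp
  have \<eta>: "0 < \<eta>" "s * \<eta> \<le> 1 / (4 * K)"
  proof -
    show "0 < \<eta>" unfolding \<eta>_def using s K by simp
    have "1 * 1 \<le> s * K" using s K by (intro mult_mono) auto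
    then have "1 / (4 * (s * K) * K) \<le> 1 / (4 * 1 * K)"
      using s K by (intro divide_left_mono mult_right_mono mult_pos_pos) auto
    then show "s * \<eta> \<le> 1 / (4 * K)"
      unfolding \<eta>_def using s K by (simp add: power2_eq_square field_simps)
  qed
  \<comment> \<open>The block starts at \<open>s0\<close> and ends at \<open>\<Phi> k = s0 + 2 C + 1\<close>.\<close>
  obtain n where n: "n \<in> {s0..<s0 + (2 * C + 2)}" and
    dec: "(2 * C + 2) * (alpha a b M * (f (y n) (x n))\<^sup>2 + (norm (w n - T (w n)))\<^sup>2) \<le> cu"
    using ex_small_decrease[OF u cu, of "2 * C + 2" s0] by auto
  define F where "F = f (y n) (x n)"
  define d where "d = alpha a b M * F\<^sup>2 + (norm (w n - T (w n)))\<^sup>2"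
  have F: "0 \<le> F" unfolding F_def by (rule value_nonneg)
  have aF: "0 \<le> alpha a b M * F\<^sup>2" using alpha_pos by simp
  have d: "0 \<le> d" unfolding d_def using aF by simp
  have "d \<le> \<eta>\<^sup>2"
  proof -
    have "cu * s ^ 4 * 16 * K ^ 4 \<le> real C" unfolding C_def by (rule real_nat_ceiling_ge)
    moreover have e2: "cu * s ^ 4 * 16 * K ^ 4 * \<eta>\<^sup>2 = cu"
      unfolding \<eta>_def using s K by (simp add: field_simps power2_eq_square power4_eq_xxxx)
    ultimately have "cu \<le> real C * \<eta>\<^sup>2" by (metis mult_right_mono zero_le_power2)
    then have "cu \<le> real (2 * C + 2) * \<eta>\<^sup>2"
      by (rule order.trans) (intro mult_right_mono, auto)
    with dec have "real (2 * C + 2) * d \<le> real (2 * C + 2) * \<eta>\<^sup>2"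
      unfolding d_def F_def by (rule order.trans)
    then show ?thesis by (rule mult_left_le_imp_le) simp
  qed
  moreover have "0 \<le> (norm (w n - T (w n)))\<^sup>2" by simp
  ultimately have "alpha a b M * F\<^sup>2 \<le> \<eta>\<^sup>2" and res2: "(norm (w n - T (w n)))\<^sup>2 \<le> \<eta>\<^sup>2"
    using aF unfolding d_def by linarith+
  then have sqF: "(sqrt (alpha a b M) * F)\<^sup>2 \<le> \<eta>\<^sup>2"
    using alpha_pos by (simp add: power_mult_distrib)
  have res: "norm (w n - T (w n)) \<le> \<eta>" by (rule power2_le_imp_le[OF res2]) (use \<eta> in simp)
  have "sqrt (alpha a b M) * F \<le> \<eta>" by (rule power2_le_imp_le[OF sqF]) (use \<eta> in simp)
  then have "s * (sqrt (alpha a b M) * F) \<le> s * \<eta>" using s by (intro mult_left_mono) auto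
  moreover have "(M * b + 1) * F \<le> (sqrt (alpha a b M) * s) * F"
    using s F by (intro mult_right_mono) auto
  ultimately have "(M * b + 1) * F \<le> 1 / (4 * K)" using \<eta>(2) by (simp only: mult_ac)
  then have MbF: "M * b * F + F \<le> 1 / (4 * K)" by (simp add: algebra_simps)
  have MbF0: "0 \<le> M * b * F" using M_pos step_bounds F by simp
  have \<eta>K: "\<eta> \<le> 1 / (4 * K)"
    using mult_right_mono[OF s(1), of \<eta>] \<eta> by linarith
  have Kq: "1 / (4 * K) \<ge> 0" "4 * (1 / (4 * K)) = 1 / (real k + 1)"
    "2 * (1 / (4 * K)) = 1 / (real (2 * k + 1) + 1)"
    using K by (auto simp: K_def divide_simps)
  have "norm (x n - w n) = lam n * F * norm (\<xi> n)"
    unfolding w_def F_def[symmetric] using F step_bounds step_size[of n] by simp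
  also have "\<dots> \<le> b * F * M"
    using F step_bounds step_size[of n] subgradient_le[of n] by (intro mult_mono) auto
  finally have xw: "norm (x n - w n) \<le> M * b * F" by (simp add: mult_ac)
  have "norm (x n - T (x n)) \<le>
      norm (x n - w n) + norm (w n - T (w n)) + norm (T (w n) - T (x n))"
    using norm_triangle_ineq[of "x n - w n" "w n - T (w n)"]
      norm_triangle_ineq[of "x n - T (w n)" "T (w n) - T (x n)"] by simp
  also have "norm (T (w n) - T (x n)) \<le> norm (x n - w n)"
    using firmly_nonexpansive_imp_nonexpansive[OF firm] by (metis norm_minus_commute)
  finally have fix_le: "norm (x n - T (x n)) \<le> 1 / (real k + 1)"
    using xw res MbF F \<eta>K Kq by linarith
  have "f (y j) (x n) \<le> 1 / (real k + 1)" if "j \<le> k" for j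
  proof -
    have "j \<le> n" "\<tau> (2 * k + 1) \<le> n" using that n unfolding s0_def by auto
    then have "f (y j) (x n) \<le> F + \<epsilon> n" "\<epsilon> n \<le> 1 / (real (2 * k + 1) + 1)"
      using earlier_value_le \<tau> unfolding F_def nondecreasing_rate_to_zero_def by blast+
    then show ?thesis using MbF MbF0 Kq by linarith
  qed
  with fix_le have "x n \<in> Omega_approx f T y k" unfolding Omega_approx_def by simp
  moreover have "n \<le> Phi_fun cu a b M L \<tau> k"
    using n unfolding Phi_fun_def C_def s0_def s_def K_def by simp
  ultimately show ?thesis by blast
qed

text \<open>
  Each of the two parts of a step contributes to the growth of the distance: the subgradient step
  \<open>\<surd>(2 b e \<delta>)\<close>, as it adds at most \<open>2 b e \<delta>\<close> to the squared distance, and \<open>T\<close> the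
  displacement \<open>\<delta>\<close> of the almost fixed point \<open>p\<close>. Together they are at most
  \<open>\<surd>\<beta> \<surd>\<delta>\<close> because \<open>\<delta> \<le> 1\<close> and \<open>M \<ge> 0\<close>.
\<close>

lemma fejer_step:
  assumes p: "norm (p - T p) \<le> \<delta>" "f (y n) p \<le> \<delta>" and \<delta>: "0 \<le> \<delta>" "\<delta> \<le> 1"
  shows "norm (x (Suc n) - p) \<le> norm (x n - p) + sqrt (beta b e M) * sqrt \<delta>"
proof -
  have be: "0 \<le> 2 * b * e" using step_bounds e_nonneg by simp
  have "(norm (w n - p))\<^sup>2 \<le> (norm (x n - p))\<^sup>2 + 2 * b * e * \<delta>"
    using subgradient_step_le[OF p(2) \<delta>(1)] alpha_pos
    by (smt (verit) mult_nonneg_nonneg zero_le_power2)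
  also have "\<dots> \<le> (norm (x n - p) + sqrt (2 * b * e * \<delta>))\<^sup>2"
    using be \<delta> by (simp add: power2_sum)
  finally have w: "norm (w n - p) \<le> norm (x n - p) + sqrt (2 * b * e * \<delta>)"
    by (rule power2_le_imp_le) (use be \<delta> in simp)
  have "x (Suc n) = T (w n)" using run_step(5)[of n] by (simp add: w_def)
  then have "norm (x (Suc n) - p) \<le> norm (T (w n) - T p) + norm (p - T p)"
    using norm_triangle_ineq4[of "T (w n) - T p" "p - T p"] by simp
  also have "\<dots> \<le> norm (w n - p) + \<delta>"
    using firmly_nonexpansive_imp_nonexpansive[OF firm] p(1) by (intro add_mono) auto
  also have "\<dots> \<le> norm (x n - p) + (sqrt (2 * b * e) * sqrt \<delta> + \<delta>)"
    using w by (simp add: real_sqrt_mult)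
  also have "sqrt (2 * b * e) * sqrt \<delta> + \<delta> \<le> sqrt (2 * b * e * (1 + M)) * sqrt \<delta> + sqrt \<delta>"
  proof (intro add_mono mult_right_mono)
    have "2 * b * e * 1 \<le> 2 * b * e * (1 + M)" using be M_pos by (intro mult_left_mono) auto
    then show "sqrt (2 * b * e) \<le> sqrt (2 * b * e * (1 + M))" by simp
    have "\<delta>\<^sup>2 \<le> \<delta>" using \<delta> by (simp add: power2_eq_square mult_left_le)
    then show "\<delta> \<le> sqrt \<delta>" by (rule real_le_rsqrt)
  qed (use \<delta> in simp)
  also have "\<dots> = sqrt (beta b e M) * sqrt \<delta>"
  proof -
    have "0 \<le> sqrt (2 * b * e * (1 + M))" using be M_pos by simp
    then show ?thesis unfolding beta_def by (simp add: algebra_simps)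
  qed
  finally show ?thesis by simp
qed

text \<open>
  The two parts of \<open>\<chi>\<close> serve different purposes: \<open>n + m\<close> makes \<open>p\<close> an approximate solution for
  each \<open>f (y j)\<close> met on the way, and the other part bounds \<open>\<delta> = 1 / (\<chi> + 1)\<close> so that \<open>m\<close>
  increases by \<open>\<surd>\<beta> \<surd>\<delta>\<close> add up to at most \<open>1 / (r + 1)\<close>.
\<close>

lemma uniformly_fejer:
  assumes p: "p \<in> Omega_approx f T y (chi b e M n m r)" and l: "l \<le> m"
  shows "norm (x (n + l) - p) \<le> norm (x n - p) + 1 / (real r + 1)"
proof -
  define X where "X = chi b e M n m r"
  define \<delta> where "\<delta> = 1 / (real X + 1)"
  have \<delta>: "0 < \<delta>" "\<delta> \<le> 1" unfolding \<delta>_def by (auto simp: field_simps)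
  have p': "norm (p - T p) \<le> \<delta>" "f (y j) p \<le> \<delta>" if "j \<le> n + m" for j
  proof -
    have "j \<le> X" using that unfolding X_def chi_def by simp
    then show "norm (p - T p) \<le> \<delta>" "f (y j) p \<le> \<delta>"
      using p unfolding X_def[symmetric] Omega_approx_def \<delta>_def by auto
  qed
  define t where "t = sqrt (beta b e M) * sqrt \<delta>"
  have t: "0 \<le> t" unfolding t_def beta_def using \<delta> by simp
  have "real m * t \<le> 1 / (real r + 1)"
  proof -
    have "\<lfloor>(real r + 1)\<^sup>2 * (real m)\<^sup>2 * beta b e M\<rfloor> \<le> int X"
      unfolding X_def chi_def by linarith
    then have "(real r + 1)\<^sup>2 * (real m)\<^sup>2 * beta b e M \<le> real X + 1" by linarith
    then have "((real r + 1)\<^sup>2 * (real m)\<^sup>2 * beta b e M) * \<delta> \<le> (real X + 1) * \<delta>"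
      using \<delta> by (intro mult_right_mono) auto
    also have "\<dots> = 1" unfolding \<delta>_def by simp
    finally have "((real r + 1) * (real m * t))\<^sup>2 \<le> 1\<^sup>2"
      unfolding t_def using \<delta> by (simp add: power_mult_distrib beta_def mult_ac)
    then have "(real r + 1) * (real m * t) \<le> 1" by (rule power2_le_imp_le) simp
    then show ?thesis by (simp add: field_simps)
  qed
  moreover have "norm (x (n + l) - p) \<le> norm (x n - p) + real l * t"
    using l
  proof (induction l)
    case (Suc l)
    then have "norm (x (Suc (n + l)) - p) \<le> norm (x (n + l) - p) + t"
      unfolding t_def using p'[of "n + l"] \<delta> by (intro fejer_step) auto
    with Suc show ?case by (simp add: algebra_simps)
  qed simp
  moreover have "real l * t \<le> real m * t" using l t by (intro mult_right_mono) auto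
  ultimately show ?thesis by linarith
qed

end

lemma mono_Phi_fun:
  assumes "0 \<le> cu" "\<And>k. \<tau> k \<le> \<tau> (k + 1)"
  shows "mono (Phi_fun cu a b M L \<tau>)"
proof (rule monoI)
  fix k k' :: nat
  assume k: "k \<le> k'"
  have \<tau>: "\<tau> (2 * k + 1) \<le> \<tau> (2 * k' + 1)"
    by (rule lift_Suc_mono_le[of \<tau>]) (use assms(2) k in auto)
  have "cu * (real (sigma_const a b M L)) ^ 4 * 16 * (real k + 1) ^ 4
      \<le> cu * (real (sigma_const a b M L)) ^ 4 * 16 * (real k' + 1) ^ 4"
    using k assms(1) by (intro mult_left_mono power_mono) auto
  then have "nat \<lceil>cu * (real (sigma_const a b M L)) ^ 4 * 16 * (real k + 1) ^ 4\<rceil>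
      \<le> nat \<lceil>cu * (real (sigma_const a b M L)) ^ 4 * 16 * (real k' + 1) ^ 4\<rceil>"
    by (intro nat_mono ceiling_mono)
  with \<tau> k show "Phi_fun cu a b M L \<tau> k \<le> Phi_fun cu a b M L \<tau> k'"
    unfolding Phi_fun_def by (intro add_mono mult_left_mono max.mono) auto
qed

section \<open>The rate of metastability\<close>

theorem theorem23:
  fixes f :: "real ^ 'n \<Rightarrow> real ^ 'n \<Rightarrow> real"
    and T :: "real ^ 'n \<Rightarrow> real ^ 'n"
    and x y \<xi> :: "nat \<Rightarrow> real ^ 'n"
    and \<rho> \<epsilon> lam :: "nat \<Rightarrow> real"
    and \<tau> :: "nat \<Rightarrow> nat"
    and \<sigma> :: "nat \<Rightarrow> nat \<Rightarrow> nat"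
    and e M a b L cu :: real
    and u :: "real ^ 'n"
  assumes "equilibrium_bifunction f"
    and "firmly_nonexpansive T"
    and "Fix T \<noteq> {}"
    and "generated_sequences f T \<epsilon> lam x \<rho> y \<xi>"
    and "\<forall>n. f (y n) (x n) \<le> e"
    and "0 < M"
    and "\<forall>n. norm (\<xi> n) \<le> M"
    and "{a..b} \<subseteq> {0<..<2 / M\<^sup>2}"
    and "\<forall>n. lam n \<in> {a..b}"
    and "diameter (range x) \<le> L"
    and "\<epsilon> \<longlonglongrightarrow> 0"
    and "nondecreasing_rate_to_zero \<tau> \<epsilon>"
    and "u \<in> Omega f T y"
    and "(norm (x 0 - u))\<^sup>2 \<le> cu"
    and "\<forall>j. modulus_uniform_continuity (\<sigma> j) (cball (x 0) L) (f (y j))"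
  shows "\<forall>(k::nat) (g::nat \<Rightarrow> nat).
           \<exists>n \<le> Sigma_tilde CARD('n) L e M a b cu \<tau> \<sigma> k g.
             \<forall>i\<in>{n..n + g n}. \<forall>j\<in>{n..n + g n}.
               norm (x i - x j) \<le> 1 / (real k + 1) \<and> x i \<in> Omega_approx f T y k"
proof (intro allI)
  fix k :: nat and g :: "nat \<Rightarrow> nat"
  interpret bounded_run f T \<epsilon> lam x \<rho> y \<xi> e M a b
    by unfold_locales (use assms in blast)+
  have L: "norm (x i - x j) \<le> L" for i j
    using assms by (intro dist_le_diameter) auto
  then have L0: "0 \<le> L" by (metis norm_ge_zero order.trans)
  have in_ball: "x i \<in> cball (x 0) L" for i using L[of 0 i] by (simp add: dist_norm)
  have cu: "0 \<le> cu" using assms(14) by (rule order.trans[OF zero_le_power2])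
  define q where "q = k0 \<sigma> k"
  have q: "k \<le> q" unfolding q_def k0_def by simp
  \<comment> \<open>This is what the second entry of the maximum in \<open>k\<^sub>0\<close> is for: \<open>2 q + 2 \<ge> \<omega>\<^sub>\<Omega> k + 1\<close>.\<close>
  have \<omega>: "1 / (2 * (real q + 1)) \<le> 1 / (real (omega_Omega \<sigma> k) + 1)"
  proof -
    have "nat \<lceil>(real (omega_Omega \<sigma> k) - 1) / 2\<rceil> \<le> q" unfolding q_def k0_def by simp
    then have "(real (omega_Omega \<sigma> k) - 1) / 2 \<le> real q" by linarith
    then show ?thesis by (intro divide_left_mono) auto
  qed
  have "\<exists>n \<le> Sigma_tilde CARD('n) L e M a b cu \<tau> \<sigma> k g.
      \<exists>m. x m \<in> Omega_approx f T y (chi_k b e M k n (g n) (4 * q + 3)) \<and>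
        (\<forall>i\<in>{n..n + g n}. dist (x i) (x m) \<le> 3 / (8 * (real q + 1)))"
    unfolding Sigma_tilde_def q_def[symmetric]
  proof (rule fejer_metastability[OF antimono_Omega_approx])
    show "mono (Phi_fun cu a b M L \<tau>)"
      using assms(12) cu unfolding nondecreasing_rate_to_zero_def by (intro mono_Phi_fun) auto
    show "\<exists>n\<le>Phi_fun cu a b M L \<tau> k. x n \<in> Omega_approx f T y k" for k
      using assms L0 by (intro approximate_solution_bound) auto
    show "dist (x (n + l)) p \<le> dist (x n) p + 1 / (real r + 1)"
      if "p \<in> Omega_approx f T y (chi_k b e M k n m r)" "l \<le> m" for n m r p l
    proof -
      have "chi b e M n m r \<le> chi_k b e M k n m r" unfolding chi_k_def by simp
      then have "p \<in> Omega_approx f T y (chi b e M n m r)"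
        by (rule antimonoD[OF antimono_Omega_approx, THEN subsetD]) (rule that(1))
      then show ?thesis using that(2) unfolding dist_norm by (rule uniformly_fejer)
    qed
    show "\<exists>i j. i < j \<and> i \<le> P_fun CARD('n) L q \<and>
        dist (x (z i)) (x (z j)) \<le> 1 / (8 * real q + 8)" for z :: "nat \<Rightarrow> nat"
      using ex_two_close_points[of "\<lambda>i. x (z i)" L "8 * real q + 8"] L
      unfolding P_fun_def dist_norm by simp
  qed
  then obtain n m where n: "n \<le> Sigma_tilde CARD('n) L e M a b cu \<tau> \<sigma> k g"
    and m: "x m \<in> Omega_approx f T y (chi_k b e M k n (g n) (4 * q + 3))"
    and near: "\<forall>i\<in>{n..n + g n}. dist (x i) (x m) \<le> 3 / (8 * (real q + 1))"
    by blast
  have "delta_Omega k \<le> chi_k b e M k n (g n) (4 * q + 3)" unfolding chi_k_def by simp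
  then have m': "x m \<in> Omega_approx f T y (delta_Omega k)"
    by (rule antimonoD[OF antimono_Omega_approx, THEN subsetD]) (rule m)
  have near': "norm (x i - x m) \<le> 1 / (2 * (real q + 1))" if "i \<in> {n..n + g n}" for i
  proof -
    have "norm (x i - x m) \<le> 3 / (8 * (real q + 1))" using near that by (simp add: dist_norm)
    also have "\<dots> \<le> 1 / (2 * (real q + 1))" by (simp add: divide_simps)
    finally show ?thesis .
  qed
  have "norm (x i - x j) \<le> 1 / (real k + 1)" "x i \<in> Omega_approx f T y k"
    if ij: "i \<in> {n..n + g n}" "j \<in> {n..n + g n}" for i j
  proof -
    have "norm (x i - x j) \<le> norm (x i - x m) + norm (x j - x m)"
      using norm_triangle_ineq4[of "x i - x m" "x j - x m"] by simp
    also have "\<dots> \<le> 1 / (2 * (real q + 1)) + 1 / (2 * (real q + 1))"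
      using near' ij by (intro add_mono) auto
    also have "\<dots> = 1 / (real q + 1)" by (simp add: divide_simps)
    also have "\<dots> \<le> 1 / (real k + 1)" using q by (simp add: field_simps)
    finally show "norm (x i - x j) \<le> 1 / (real k + 1)" .
    show "x i \<in> Omega_approx f T y k"
    proof (rule Omega_approx_near[OF firm _ in_ball in_ball m'])
      show "modulus_uniform_continuity (\<sigma> j) (cball (x 0) L) (f (y j))" for j
        using assms(15) by blast
      show "norm (x i - x m) \<le> 1 / (real (omega_Omega \<sigma> k) + 1)"
        by (rule order.trans[OF near'[OF ij(1)] \<omega>])
    qed
  qed
  with n show "\<exists>n \<le> Sigma_tilde CARD('n) L e M a b cu \<tau> \<sigma> k g.
      \<forall>i\<in>{n..n + g n}. \<forall>j\<in>{n..n + g n}.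
        norm (x i - x j) \<le> 1 / (real k + 1) \<and> x i \<in> Omega_approx f T y k"
    by blast
qed

end
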